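(* Let $f:\mathcal{S}^n\to\mathbb{R}$ be convex and continuous, let $\mathcal{A}:\mathcal{S}^n\to\mathbb{R}^m$ be linear, let $x_0\in\mathbb{R}^n$, $X_0=x_0x_0^t$, and let $b=\mathcal{A}(X_0)$. If $X_0$ minimizes $$\min f(X)\ \text{ subject to }\ X\succeq 0,\ \mathcal{A}(X)=b,$$ then there exist a positive integer $\tilde m$, a linear map $\tilde{\mathcal{A}}:\mathcal{S}^n\to\mathbb{R}^{\tilde m}$ and a vector $\tilde b\in\mathbb{R}^{\tilde m}$ such that $$\{X\in\mathcal{S}^n : X\succeq 0,\ \mathcal{A}(X)=b\}=\{X\in\mathcal{S}^n : X\succeq 0,\ \tilde{\mathcal{A}}(X)=\tilde b\}$$ and there exists a dual certificate at $X_0$ for the problem $$\min f(X)\ \text{ subject to }\ X\succeq 0,\ \tilde{\mathcal{A}}(X)=\tilde b.$$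
   Context: $\mathcal{S}^n$ is the space of real symmetric $n\times n$ matrices with inner product $\langle X,Y\rangle=\operatorname{tr}(Y^tX)$; $\perp$ denotes orthogonality for this inner product. $X\succeq 0$ (resp. $X\preceq 0$) means $X$ is positive (resp. negative) semidefinite. $\partial f$ denotes the convex subdifferential with respect to $\langle\cdot,\cdot\rangle$ on $\mathcal{S}^n$. For a linear map $\mathcal{B}:\mathcal{S}^n\to\mathbb{R}^k$ with adjoint $\mathcal{B}^*$ and $c=\mathcal{B}(X_0)$, a dual certificate at $X_0$ for the problem $\min f(X)$ subject to $X\succeq 0$, $\mathcal{B}(X)=c$ is a pair $(\lambda,Q)\in\mathbb{R}^k\times\mathcal{S}^n$ such that $\mathcal{B}^*\lambda+Q\in-\partial f(X_0)$, $Q\preceq 0$, and $Q\perp X_0$. *)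

theory Defs
  imports "HOL-Analysis.Analysis"
begin

text \<open>
  The space of symmetric matrices is the carrier set \<open>Sym\<close> inside \<open>real ^ 'n ^ 'n\<close>; its
  topology and convex structure are the ones inherited from the ambient space.
  Functions on it are HOL functions on the ambient type of which only the values on \<open>Sym\<close>
  are ever used.  Since the number of constraints is quantified existentially, a vector of
  \<open>\<real>\<^sup>k\<close> is a function \<open>nat \<Rightarrow> real\<close> of which only the entries with index \<open>i < k\<close> are ever
  used, and a map into \<open>\<real>\<^sup>k\<close> is given by its coordinate functions \<open>\<lambda>X. B X i\<close>, \<open>i < k\<close>.
\<close>

definition Sym :: "(real ^ 'n ^ 'n) set" where
  "Sym = {X. transpose X = X}"

definition sym_inner :: "real ^ 'n ^ 'n \<Rightarrow> real ^ 'n ^ 'n \<Rightarrow> real" where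
  "sym_inner X Y = trace (transpose Y ** X)"

definition psd :: "real ^ 'n ^ 'n \<Rightarrow> bool" where
  "psd X \<longleftrightarrow> X \<in> Sym \<and> (\<forall>v. v \<bullet> (X *v v) \<ge> 0)"

definition nsd :: "real ^ 'n ^ 'n \<Rightarrow> bool" where
  "nsd X \<longleftrightarrow> X \<in> Sym \<and> (\<forall>v. v \<bullet> (X *v v) \<le> 0)"

definition subdiff :: "(real ^ 'n ^ 'n \<Rightarrow> real) \<Rightarrow> real ^ 'n ^ 'n \<Rightarrow> (real ^ 'n ^ 'n) set" where
  "subdiff f X0 = {G \<in> Sym. \<forall>X\<in>Sym. f X \<ge> f X0 + sym_inner G (X - X0)}"

definition linear_Sym :: "nat \<Rightarrow> (real ^ 'n ^ 'n \<Rightarrow> nat \<Rightarrow> real) \<Rightarrow> bool" where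
  "linear_Sym k B \<longleftrightarrow>
     (\<forall>X\<in>Sym. \<forall>Y\<in>Sym. \<forall>i<k. B (X + Y) i = B X i + B Y i) \<and>
     (\<forall>c. \<forall>X\<in>Sym. \<forall>i<k. B (c *\<^sub>R X) i = c * B X i)"

text \<open>For linear \<open>B\<close> the description below determines a unique matrix, see \<open>ex1_adjoint_Sym\<close>.\<close>

definition adjoint_Sym ::
  "nat \<Rightarrow> (real ^ 'n ^ 'n \<Rightarrow> nat \<Rightarrow> real) \<Rightarrow> (nat \<Rightarrow> real) \<Rightarrow> real ^ 'n ^ 'n" where
  "adjoint_Sym k B l = (THE Y. Y \<in> Sym \<and> (\<forall>X\<in>Sym. sym_inner X Y = (\<Sum>i<k. B X i * l i)))"

definition feasible ::
  "nat \<Rightarrow> (real ^ 'n ^ 'n \<Rightarrow> nat \<Rightarrow> real) \<Rightarrow> (nat \<Rightarrow> real) \<Rightarrow> (real ^ 'n ^ 'n) set" where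
  "feasible k B c = {X \<in> Sym. psd X \<and> (\<forall>i<k. B X i = c i)}"

definition dual_certificate ::
  "(real ^ 'n ^ 'n \<Rightarrow> real) \<Rightarrow> nat \<Rightarrow> (real ^ 'n ^ 'n \<Rightarrow> nat \<Rightarrow> real) \<Rightarrow> (nat \<Rightarrow> real) \<Rightarrow>
     real ^ 'n ^ 'n \<Rightarrow> (nat \<Rightarrow> real) \<Rightarrow> real ^ 'n ^ 'n \<Rightarrow> bool" where
  "dual_certificate f k B c X0 l Q \<longleftrightarrow>
     (\<forall>i<k. c i = B X0 i) \<and>
     adjoint_Sym k B l + Q \<in> uminus ` subdiff f X0 \<and>
     nsd Q \<and> sym_inner Q X0 = 0"

lemma sym_inner_eq_inner: "sym_inner X Y = X \<bullet> Y"
proof -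
  have "sym_inner X Y = (\<Sum>j\<in>UNIV. \<Sum>i\<in>UNIV. Y $ i $ j * X $ i $ j)"
    by (simp add: sym_inner_def trace_def matrix_matrix_mult_def transpose_def)
  also have "\<dots> = X \<bullet> Y"
    by (subst sum.swap) (simp add: inner_vec_def mult.commute)
  finally show ?thesis .
qed

lemma subspace_Sym: "subspace Sym"
  by (auto simp: subspace_def Sym_def transpose_def vec_eq_iff)

lemma inner_transpose: "transpose X \<bullet> Y = X \<bullet> transpose (Y :: real ^ 'n ^ 'n)"
  unfolding inner_vec_def transpose_def by (subst sum.swap) simp

lemma ex1_adjoint_Sym:
  fixes B :: "real ^ 'n ^ 'n \<Rightarrow> nat \<Rightarrow> real"
  assumes "linear_Sym k B"
  shows "\<exists>!Y. Y \<in> Sym \<and> (\<forall>X\<in>Sym. sym_inner X Y = (\<Sum>i<k. B X i * l i))"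
proof (rule ex_ex1I)
  define s :: "real ^ 'n ^ 'n \<Rightarrow> real ^ 'n ^ 'n" where "s X = (1/2) *\<^sub>R (X + transpose X)" for X
  define g where "g X = (\<Sum>i<k. B (s X) i * l i)" for X
  have s_in: "s X \<in> Sym" for X
    by (simp add: s_def Sym_def transpose_def vec_eq_iff add.commute)
  have s_id: "s X = X" if "X \<in> Sym" for X
    using that by (simp add: s_def Sym_def flip: scaleR_2)
  have s_tr: "s (transpose X) = s X" for X
    by (simp add: s_def add.commute)
  have s_add: "s (X + Y) = s X + s Y" for X Y
    by (simp add: s_def transpose_def vec_eq_iff field_simps)
  have s_scale: "s (c *\<^sub>R X) = c *\<^sub>R s X" for c X
    by (simp add: s_def transpose_def vec_eq_iff algebra_simps)
  have lin: "linear g"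
  proof (rule linearI)
    show "g (X + Y) = g X + g Y" for X Y
      using assms s_in
      by (simp add: g_def s_add linear_Sym_def sum.distrib[symmetric] distrib_right)
    show "g (c *\<^sub>R X) = c *\<^sub>R g X" for c X
      using assms s_in by (simp add: g_def s_scale linear_Sym_def sum_distrib_left mult.assoc)
  qed
  define Y where "Y = adjoint g 1"
  have Y: "X \<bullet> Y = g X" for X
    using adjoint_works[OF lin, of X 1] by (simp add: Y_def)
  have "X \<bullet> transpose Y = X \<bullet> Y" for X
    using Y[of "transpose X"] Y[of X] by (simp add: inner_transpose g_def s_tr)
  then have "transpose Y = Y"
    by (subst vector_eq_ldot[symmetric]) blast
  then show "\<exists>Y. Y \<in> Sym \<and> (\<forall>X\<in>Sym. sym_inner X Y = (\<Sum>i<k. B X i * l i))"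
    by (intro exI[of _ Y]) (auto simp: Sym_def sym_inner_eq_inner Y g_def s_id)
next
  fix Y Z :: "real ^ 'n ^ 'n"
  assume Y: "Y \<in> Sym \<and> (\<forall>X\<in>Sym. sym_inner X Y = (\<Sum>i<k. B X i * l i))"
    and Z: "Z \<in> Sym \<and> (\<forall>X\<in>Sym. sym_inner X Z = (\<Sum>i<k. B X i * l i))"
  then have "Y - Z \<in> Sym"
    using subspace_Sym subspace_diff by blast
  with Y Z have "(Y - Z) \<bullet> Y = (Y - Z) \<bullet> Z"
    unfolding sym_inner_eq_inner by metis
  then have "(Y - Z) \<bullet> (Y - Z) = 0"
    by (simp only: inner_diff_right[of "Y - Z"] cancel_comm_monoid_add_class.diff_cancel)
  then show "Y = Z" by simp
qed

end

theory Submission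
  imports Defs
begin

text \<open>
  Separating the epigraph of \<open>f\<close> from the feasible set \<open>F\<close> gives \<open>G \<in> \<partial>f(X0)\<close> with
  \<open>\<langle>G, X - X0\<rangle> \<ge> 0\<close> on \<open>F\<close>.  Slater's condition holds relative to the minimal face of the
  positive semidefinite cone containing \<open>F\<close>, so some \<open>q\<close> with \<open>\<langle>q, X0\<rangle> = 0\<close> is nonpositive on
  this face and \<open>G + q\<close> is orthogonal to \<open>F - X0\<close>.  A congruence turns \<open>q\<close> into a negative
  semidefinite \<open>Q\<close> without changing it on the face.  As \<open>- G - Q\<close> is constant on \<open>F\<close>, it can be
  added to the constraints as one further row, and the certificate puts all weight on that row.
\<close>

section \<open>Separation and subgradients inside a subspace\<close>

text \<open>For nonempty \<open>C\<close>, a functional \<open>(a, \<beta>)\<close> separating 0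
  from \<open>C\<close> has \<open>\<beta> \<ge> 0\<close> because \<open>C\<close> is closed
  upwards, and \<open>nonvert\<close> excludes \<open>\<beta> = 0\<close>, so it can be normalised
  by \<open>\<beta>\<close>. Taking it in the span of \<open>C\<close> keeps \<open>a\<close> in
  \<open>T\<close>.\<close>

lemma supporting_nonvertical_hyperplane:
  fixes T :: "'a::euclidean_space set" and C :: "('a \<times> real) set"
  assumes T: "subspace T" and sub: "C \<subseteq> T \<times> UNIV" and conv: "convex C" and C0: "0 \<notin> C"
    and up: "\<And>z r r'. (z, r) \<in> C \<Longrightarrow> r < r' \<Longrightarrow> (z, r') \<in> C"
    and nonvert: "\<And>a. a \<in> T \<Longrightarrow> (\<And>z r. (z, r) \<in> C \<Longrightarrow> 0 \<le> a \<bullet> z) \<Longrightarrow> a = 0"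
  obtains g where "g \<in> T" "\<And>z r. (z, r) \<in> C \<Longrightarrow> 0 \<le> g \<bullet> z + r"
proof (cases "C = {}")
  case True
  show thesis using that[of 0] T True by (auto simp: subspace_0)
next
  case False
  obtain p where p: "p \<in> span C" "p \<noteq> 0" "\<And>x. x \<in> C \<Longrightarrow> 0 \<le> p \<bullet> x"
    using separating_hyperplane_set_0_inspan[OF conv False C0] by metis
  obtain a \<beta> where ab: "p = (a, \<beta>)" by (cases p)
  have "span C \<subseteq> T \<times> UNIV"
    using sub T by (intro span_minimal subspace_Times) auto
  then have aT: "a \<in> T" using p(1) ab by auto
  have sep: "0 \<le> a \<bullet> z + \<beta> * r" if "(z, r) \<in> C" for z r
    using p(3)[OF that] ab by (simp add: inner_prod_def)
  have "0 \<le> \<beta>"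
  proof (rule ccontr)
    assume neg: "\<not> 0 \<le> \<beta>"
    obtain z r where zr: "(z, r) \<in> C" using False by auto
    \<comment> \<open>At this height a negative \<open>\<beta>\<close> would give
      \<open>a \<bullet> z + \<beta> * r' \<le> -1\<close>.\<close>
    define r' where "r' = max (r + 1) ((a \<bullet> z + 1) / - \<beta>)"
    have "(a \<bullet> z + 1) / - \<beta> \<le> r'" by (simp add: r'_def)
    then have "a \<bullet> z + 1 \<le> r' * - \<beta>" using neg by (simp add: pos_divide_le_eq del: divide_minus_right)
    moreover have "0 \<le> a \<bullet> z + \<beta> * r'" using up[OF zr, of r'] sep by (auto simp: r'_def)
    ultimately show False by (simp add: mult.commute)
  qed
  moreover have "\<beta> \<noteq> 0"
  proof
    assume "\<beta> = 0"
    with sep have "a = 0" by (intro nonvert aT) auto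
    with \<open>\<beta> = 0\<close> p(2) ab show False by (simp add: zero_prod_def)
  qed
  ultimately have pos: "\<beta> > 0" by simp
  show thesis
  proof (rule that[of "a /\<^sub>R \<beta>"])
    show "a /\<^sub>R \<beta> \<in> T" using T aT by (rule subspace_scale)
    fix z r assume "(z, r) \<in> C"
    from sep[OF this] have "0 \<le> (a \<bullet> z + \<beta> * r) / \<beta>" using pos by simp
    then show "0 \<le> (a /\<^sub>R \<beta>) \<bullet> z + r" using pos by (simp add: field_simps)
  qed
qed

text \<open>Separation is applied to the strict epigraph translated by \<open>- F\<close>;
  minimality keeps the origin out. Two specialisations are intended: \<open>y = x0\<close> makes
  \<open>G\<close> a subgradient at \<open>x0\<close>, and \<open>x = x0\<close> gives
  \<open>G \<bullet> (y - x0) \<ge> 0\<close> on \<open>F\<close>.\<close>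

lemma constrained_minimum_subgradient:
  fixes f :: "'a::euclidean_space \<Rightarrow> real"
  assumes S: "subspace S" and f: "convex_on S f" and F: "convex F" "F \<subseteq> S" "x0 \<in> F"
    and min: "\<And>y. y \<in> F \<Longrightarrow> f x0 \<le> f y"
  obtains G where "G \<in> S" "\<And>x y. x \<in> S \<Longrightarrow> y \<in> F \<Longrightarrow> f x0 + G \<bullet> (x - y) \<le> f x"
proof -
  define C where "C = {(x - y, r) | x y r. x \<in> S \<and> y \<in> F \<and> f x - f x0 < r}"
  obtain g where g: "g \<in> S" "\<And>z r. (z, r) \<in> C \<Longrightarrow> 0 \<le> g \<bullet> z + r"
  proof (rule supporting_nonvertical_hyperplane[OF S, of C])
    show "C \<subseteq> S \<times> UNIV"
      using F S by (auto simp: C_def intro: subspace_diff)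
    show "convex C"
    proof (rule convexI)
      fix p q and u v :: real
      assume p: "p \<in> C" and q: "q \<in> C" and uv: "0 \<le> u" "0 \<le> v" "u + v = 1"
      obtain x y r where 1: "p = (x - y, r)" "x \<in> S" "y \<in> F" "f x - f x0 < r"
        using p by (auto simp: C_def)
      obtain x' y' r' where 2: "q = (x' - y', r')" "x' \<in> S" "y' \<in> F" "f x' - f x0 < r'"
        using q by (auto simp: C_def)
      have "f (u *\<^sub>R x + v *\<^sub>R x') \<le> u * f x + v * f x'"
        using f uv 1 2 by (auto simp: convex_on_def)
      moreover have "u * (f x - f x0) + v * (f x' - f x0) < u * r + v * r'"
      \<comment> \<open>Strictness must come from a summand with positive weight: the second if
        \<open>u = 0\<close>, the first otherwise.\<close>
      proof (cases "u = 0")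
        case True
        then show ?thesis using uv 2 by simp
      next
        case False
        then show ?thesis
          using uv 1 2 by (intro add_less_le_mono mult_left_mono mult_strict_left_mono) auto
      qed
      moreover have "u * (f x - f x0) + v * (f x' - f x0) = u * f x + v * f x' - f x0"
        using uv(3) by (simp add: algebra_simps flip: distrib_right)
      ultimately have "f (u *\<^sub>R x + v *\<^sub>R x') - f x0 < u * r + v * r'" by linarith
      moreover have "u *\<^sub>R x + v *\<^sub>R x' \<in> S"
        using S 1 2 by (intro subspace_add subspace_scale)
      moreover have "u *\<^sub>R y + v *\<^sub>R y' \<in> F"
        using F(1) 1 2 uv by (auto simp: convex_def)
      moreover have "u *\<^sub>R p + v *\<^sub>R q =
          ((u *\<^sub>R x + v *\<^sub>R x') - (u *\<^sub>R y + v *\<^sub>R y'), u * r + v * r')"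
        by (simp add: 1 2 algebra_simps)
      ultimately show "u *\<^sub>R p + v *\<^sub>R q \<in> C"
        unfolding C_def by blast
    qed
    show "0 \<notin> C"
      using min by (force simp: C_def zero_prod_def)
    show "(z, r') \<in> C" if "(z, r) \<in> C" "r < r'" for z r r'
      using that by (force simp: C_def)
    show "a = 0" if "a \<in> S" and a: "\<And>z r. (z, r) \<in> C \<Longrightarrow> 0 \<le> a \<bullet> z" for a
    proof -
      \<comment> \<open>The point \<open>x0 - a\<close> has offset \<open>- a\<close> from
        \<open>x0\<close>, so the inequality for \<open>a\<close> reads
        \<open>0 \<le> - (a \<bullet> a)\<close>.\<close>
      have "x0 - a \<in> S" using F S \<open>a \<in> S\<close> by (auto intro: subspace_diff)
      then have "((x0 - a) - x0, f (x0 - a) - f x0 + 1) \<in> C"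
        using F(3) unfolding C_def by (intro CollectI exI conjI) (auto intro: refl)
      from a[OF this] have "a \<bullet> a \<le> 0" by simp
      then show ?thesis by (metis inner_ge_zero inner_eq_zero_iff order_antisym)
    qed
  qed auto
  show thesis
  proof (rule that[of "- g"])
    show "- g \<in> S" using S g(1) by (rule subspace_neg)
    fix x y assume xy: "x \<in> S" "y \<in> F"
    show "f x0 + - g \<bullet> (x - y) \<le> f x"
    proof (rule field_le_epsilon)
      fix e :: real assume "e > 0"
      with xy have "(x - y, f x - f x0 + e) \<in> C" by (force simp: C_def)
      from g(2)[OF this] show "f x0 + - g \<bullet> (x - y) \<le> f x + e" by simp
    qed
  qed
qed

section \<open>Multipliers on the minimal face of a cone\<close>

text \<open>
  No constraint qualification is needed because nonpositivity of the multiplier \<open>q\<close> is only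
  claimed on the minimal face of \<open>K\<close> containing the feasible set; in the span of that face
  the point \<open>xs\<close> is a Slater point.
\<close>
lemma minimal_face_multiplier:
  fixes K M :: "'a::euclidean_space set"
  assumes K0: "0 \<in> K" and Kadd: "\<And>x y. x \<in> K \<Longrightarrow> y \<in> K \<Longrightarrow> x + y \<in> K"
    and Kscale: "\<And>c x. 0 \<le> c \<Longrightarrow> x \<in> K \<Longrightarrow> c *\<^sub>R x \<in> K"
    and M: "affine M" and x0: "x0 \<in> K" "x0 \<in> M"
    and G: "\<And>x. x \<in> K \<Longrightarrow> x \<in> M \<Longrightarrow> 0 \<le> G \<bullet> (x - x0)"
  obtains xs q where "xs \<in> K" "q \<in> span K"
    "\<And>x. x \<in> K \<Longrightarrow> x \<in> M \<Longrightarrow> \<exists>e>0. xs - e *\<^sub>R x \<in> K"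
    "\<And>p e. p \<in> K \<Longrightarrow> 0 < e \<Longrightarrow> xs - e *\<^sub>R p \<in> K \<Longrightarrow> q \<bullet> p \<le> 0"
    "q \<bullet> x0 = 0"
    "\<And>x. x \<in> K \<Longrightarrow> x \<in> M \<Longrightarrow> (G + q) \<bullet> (x - x0) = 0"
proof -
  define F where "F = K \<inter> M"
  have convK: "convex K" by (auto simp: convex_def intro: Kadd Kscale)
  have convF: "convex F"
    unfolding F_def by (rule convex_Int[OF convK affine_imp_convex[OF M]])
  have x0F: "x0 \<in> F" using x0 by (simp add: F_def)
  obtain xs where xs: "xs \<in> rel_interior F"
    using rel_interior_eq_empty[OF convF] x0F by auto
  have xsF: "xs \<in> F" using xs rel_interior_subset by auto
  then have xsK: "xs \<in> K" by (simp add: F_def)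
  have hullM: "affine hull F \<subseteq> M"
    using M by (intro hull_minimal) (auto simp: F_def)
  \<comment> \<open>This is the face of \<open>K\<close> generated by \<open>xs\<close>. It contains
    all of \<open>F\<close> because \<open>xs\<close> is a relative interior point of
    \<open>F\<close>.\<close>
  define P where "P = {p \<in> K. \<exists>e>0. xs - e *\<^sub>R p \<in> K}"
  have PI: "p \<in> P" if "p \<in> K" "e > 0" "xs - e *\<^sub>R p \<in> K" for p e
    using that by (auto simp: P_def)
  have FP: "x \<in> P" if "x \<in> F" for x
  proof -
    have "x \<in> affine hull F" using that by (simp add: hull_inc)
    \<comment> \<open>The segment from \<open>x\<close> to \<open>xs\<close> extends beyond
      \<open>xs\<close> inside \<open>F\<close>; dividing the new endpoint by \<open>e\<close>
      leaves \<open>xs\<close> minus a positive multiple of \<open>x\<close>.\<close>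
    then obtain e where e: "e > 1" "(1 - e) *\<^sub>R x + e *\<^sub>R xs \<in> F"
      using convex_rel_interior_if2[OF convF xs] by blast
    then have "(1 / e) *\<^sub>R ((1 - e) *\<^sub>R x + e *\<^sub>R xs) \<in> K"
      by (intro Kscale) (auto simp: F_def)
    moreover have "(1 / e) *\<^sub>R ((1 - e) *\<^sub>R x + e *\<^sub>R xs) = xs - ((e - 1) / e) *\<^sub>R x"
      using e(1) by (simp add: algebra_simps diff_divide_distrib)
    ultimately show ?thesis
      using e that by (intro PI[of x "(e - 1) / e"]) (auto simp: F_def)
  qed
  have P0: "0 \<in> P" using K0 xsK by (intro PI[of 0 1]) auto
  have Pscale: "c *\<^sub>R p \<in> P" if c: "0 \<le> c" and p: "p \<in> P" for c p
  proof (cases "c = 0")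
    case True then show ?thesis using P0 by simp
  next
    case False
    obtain e where "e > 0" "xs - e *\<^sub>R p \<in> K" "p \<in> K" using p by (auto simp: P_def)
    then show ?thesis using c False by (intro PI[of _ "e / c"]) (auto intro: Kscale)
  qed
  have Padd: "p + p' \<in> P" if p: "p \<in> P" "p' \<in> P" for p p'
  proof -
    obtain e e' where e: "e > 0" "xs - e *\<^sub>R p \<in> K" "p \<in> K"
      and e': "e' > 0" "xs - e' *\<^sub>R p' \<in> K" "p' \<in> K" using p by (auto simp: P_def)
    \<comment> \<open>The convex weights \<open>e' / (e + e')\<close> and
      \<open>e / (e + e')\<close> give \<open>p\<close> and \<open>p'\<close> the same coefficient
      \<open>d\<close>.\<close>
    define d where "d = e * e' / (e + e')"
    have "(e' / (e + e')) *\<^sub>R (xs - e *\<^sub>R p) + (e / (e + e')) *\<^sub>R (xs - e' *\<^sub>R p') \<in> K"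
      using e e' by (intro Kadd Kscale) auto
    moreover have "(e' / (e + e')) *\<^sub>R (xs - e *\<^sub>R p) + (e / (e + e')) *\<^sub>R (xs - e' *\<^sub>R p')
        = (e' / (e + e') + e / (e + e')) *\<^sub>R xs - d *\<^sub>R (p + p')"
      by (simp add: d_def algebra_simps)
    moreover have "e' / (e + e') + e / (e + e') = 1"
      using e e' by (simp add: add_divide_distrib[symmetric] add.commute)
    ultimately show ?thesis
      using e e' by (intro PI[of _ d]) (auto simp: d_def intro: Kadd)
  qed
  have spanP: "span P \<subseteq> span K" by (intro span_mono) (auto simp: P_def)
  have hullP: "affine hull F \<subseteq> span P"
    using FP affine_hull_subset_span[of F] span_mono[of F P] by auto
  \<comment> \<open>Here \<open>x\<close> ranges over the affine hull, not just over
    \<open>F\<close>, so that the resulting inequality can later be reflected into an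
    equality.\<close>
  define C where "C = {(x - p, r) | x p r. x \<in> affine hull F \<and> p \<in> P \<and> G \<bullet> (x - x0) < r}"
  have CI: "(x - p, r) \<in> C" if "x \<in> affine hull F" "p \<in> P" "G \<bullet> (x - x0) < r" for x p r
    using that by (auto simp: C_def)
  obtain q where q: "q \<in> span P" "\<And>z r. (z, r) \<in> C \<Longrightarrow> 0 \<le> q \<bullet> z + r"
  proof (rule supporting_nonvertical_hyperplane[of "span P" C])
    show "C \<subseteq> span P \<times> UNIV"
      using hullP by (auto simp: C_def intro!: span_diff intro: span_base)
    show "convex C"
    proof (rule convexI)
      fix s t and u v :: real
      assume s: "s \<in> C" and t: "t \<in> C" and uv: "0 \<le> u" "0 \<le> v" "u + v = 1"
      obtain x p r where 1: "s = (x - p, r)" "x \<in> affine hull F" "p \<in> P" "G \<bullet> (x - x0) < r"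
        using s by (auto simp: C_def)
      obtain x' p' r' where 2: "t = (x' - p', r')" "x' \<in> affine hull F" "p' \<in> P" "G \<bullet> (x' - x0) < r'"
        using t by (auto simp: C_def)
      have "u * (G \<bullet> (x - x0)) + v * (G \<bullet> (x' - x0)) < u * r + v * r'"
      proof (cases "u = 0")
        case True
        then show ?thesis using uv 2 by simp
      next
        case False
        then show ?thesis
          using uv 1 2 by (intro add_less_le_mono mult_left_mono mult_strict_left_mono) auto
      qed
      moreover have "u * (G \<bullet> (x - x0)) + v * (G \<bullet> (x' - x0))
          = u * (G \<bullet> x) + v * (G \<bullet> x') - (u + v) * (G \<bullet> x0)"
        by (simp add: inner_diff_right algebra_simps)
      ultimately have "G \<bullet> ((u *\<^sub>R x + v *\<^sub>R x') - x0) < u * r + v * r'"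
        using uv(3) by (simp add: inner_diff_right inner_add_right)
      moreover have "u *\<^sub>R x + v *\<^sub>R x' \<in> affine hull F"
        using 1 2 uv by (intro mem_affine affine_affine_hull)
      moreover have "u *\<^sub>R p + v *\<^sub>R p' \<in> P"
        using 1 2 uv by (intro Padd Pscale)
      moreover have "u *\<^sub>R s + v *\<^sub>R t =
          ((u *\<^sub>R x + v *\<^sub>R x') - (u *\<^sub>R p + v *\<^sub>R p'), u * r + v * r')"
        by (simp add: 1 2 algebra_simps)
      ultimately show "u *\<^sub>R s + v *\<^sub>R t \<in> C"
        using CI by simp
    qed
    show "0 \<notin> C"
    proof
      assume "0 \<in> C"
      then obtain x where x: "x \<in> affine hull F" "x \<in> P" "G \<bullet> (x - x0) < 0"
        by (auto simp: C_def zero_prod_def)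
      then have "x \<in> K" "x \<in> M" using hullM by (auto simp: P_def)
      with G x(3) show False by fastforce
    qed
    show "(z, r') \<in> C" if "(z, r) \<in> C" "r < r'" for z r r'
      using that by (force simp: C_def)
    show "a = 0" if aP: "a \<in> span P" and a: "\<And>z r. (z, r) \<in> C \<Longrightarrow> 0 \<le> a \<bullet> z" for a
    proof -
      \<comment> \<open>The inequality bounds \<open>a\<close> on the face by its value at
        \<open>xs\<close>, and the points 0 and \<open>2 *\<^sub>R xs\<close> force that value to be
        0. As \<open>xs - e *\<^sub>R p\<close> is in the face too, \<open>a\<close> vanishes on the
        face and on its span, to which \<open>a\<close> itself belongs.\<close>
      have xsh: "xs \<in> affine hull F" using xsF by (simp add: hull_inc)
      have le: "a \<bullet> p \<le> a \<bullet> xs" if "p \<in> P" for p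
        using a[OF CI[OF xsh that, of "G \<bullet> (xs - x0) + 1"]] by (simp add: inner_diff_right)
      have "xs \<in> P" using FP xsF by simp
      then have "2 *\<^sub>R xs \<in> P" by (intro Pscale) auto
      from le[OF this] le[OF P0] have axs: "a \<bullet> xs = 0" by simp
      have "a \<bullet> p = 0" if p: "p \<in> P" for p
      proof -
        obtain e where e: "e > 0" "xs - e *\<^sub>R p \<in> K" "p \<in> K" using p by (auto simp: P_def)
        then have "xs - e *\<^sub>R p \<in> P"
          by (intro PI[of _ 1]) (auto intro: Kscale)
        from le[OF this] le[OF p] axs e(1) show ?thesis
          by (auto simp: inner_diff_right zero_le_mult_iff)
      qed
      then have "orthogonal a a"
        using aP by (intro orthogonal_to_span[of a P]) (auto simp: orthogonal_def)
      then show ?thesis by (simp add: orthogonal_self)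
    qed
  qed auto
  have q': "0 \<le> q \<bullet> (x - p) + G \<bullet> (x - x0)" if "x \<in> affine hull F" "p \<in> P" for x p
  proof (rule field_le_epsilon)
    fix e :: real assume "e > 0"
    then show "0 \<le> q \<bullet> (x - p) + G \<bullet> (x - x0) + e"
      using q(2)[OF CI[OF that, of "G \<bullet> (x - x0) + e"]] by simp
  qed
  have x0h: "x0 \<in> affine hull F" using x0F by (simp add: hull_inc)
  have qx0_ge: "q \<bullet> p \<le> q \<bullet> x0" if "p \<in> P" for p
    using q'[OF x0h that] by (simp add: inner_diff_right)
  \<comment> \<open>The maximum of \<open>q\<close> over the cone \<open>P\<close>, attained at
    \<open>x0\<close>, can only be 0.\<close>
  have "2 *\<^sub>R x0 \<in> P" using FP x0F by (intro Pscale) auto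
  from qx0_ge[OF this] qx0_ge[OF P0] have qx0: "q \<bullet> x0 = 0" by simp
  show thesis
  proof (rule that[of xs q])
    show "xs \<in> K" by fact
    show "q \<in> span K" using q(1) spanP by auto
    show "\<exists>e>0. xs - e *\<^sub>R x \<in> K" if "x \<in> K" "x \<in> M" for x
      using FP[of x] that by (auto simp: F_def P_def)
    show "q \<bullet> p \<le> 0" if "p \<in> K" "0 < e" "xs - e *\<^sub>R p \<in> K" for p e
      using qx0_ge[OF PI[OF that]] qx0 by simp
    show "q \<bullet> x0 = 0" by fact
    show "(G + q) \<bullet> (x - x0) = 0" if "x \<in> K" "x \<in> M" for x
    proof -
      have xh: "x \<in> affine hull F" using that by (simp add: F_def hull_inc)
      \<comment> \<open>The reflection of \<open>x\<close> in \<open>x0\<close> stays in the affine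
        hull and supplies the opposite inequality.\<close>
      then have "2 *\<^sub>R x0 + (-1) *\<^sub>R x \<in> affine hull F"
        using x0h by (intro mem_affine affine_affine_hull) auto
      from q'[OF this P0] q'[OF xh P0] qx0 show ?thesis
        by (simp add: inner_diff_right inner_add_left inner_add_right)
    qed
  qed
qed

section \<open>Cauchy-Schwarz inequality and kernels of semidefinite forms\<close>

text \<open>The form is nonnegative at \<open>u - (c * k) *\<^sub>R w\<close> with
  \<open>k = u \<bullet> (X *v w)\<close>. This is Cauchy-Schwarz with \<open>c\<close> in place of
  the reciprocal of \<open>w \<bullet> (X *v w)\<close>, so that a vanishing form at
  \<open>w\<close> is covered.\<close>

lemma psd_form_square_le:
  assumes X: "psd X" and c: "0 \<le> c" "c * (w \<bullet> (X *v w)) \<le> 1"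
  shows "c * (u \<bullet> (X *v w))\<^sup>2 \<le> u \<bullet> (X *v u)"
proof -
  define k where "k = u \<bullet> (X *v w)"
  have "w \<bullet> (X *v u) = k"
    using X transpose_matrix_vector[of X w] dot_lmul_matrix[of w X u]
    by (simp add: k_def psd_def Sym_def inner_commute del: transpose_matrix_vector)
  moreover have "0 \<le> (u - (c * k) *\<^sub>R w) \<bullet> (X *v (u - (c * k) *\<^sub>R w))"
    using X by (simp add: psd_def)
  ultimately have "0 \<le> u \<bullet> (X *v u) - 2 * (c * k\<^sup>2) + (c * (w \<bullet> (X *v w))) * (c * k\<^sup>2)"
    by (simp add: matrix_vector_mult_diff_distrib matrix_vector_mult_scaleR inner_diff_left
        inner_diff_right power2_eq_square k_def algebra_simps)
  moreover have "(c * (w \<bullet> (X *v w))) * (c * k\<^sup>2) \<le> 1 * (c * k\<^sup>2)"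
    using c by (intro mult_right_mono) auto
  ultimately show ?thesis by (simp add: k_def)
qed

text \<open>When the form is zero at \<open>w\<close>, the factor \<open>c\<close> in
  \<open>psd_form_square_le\<close> may be arbitrarily large, which forces
  \<open>u \<bullet> (X *v w) = 0\<close>, in particular for \<open>u = X *v w\<close>.\<close>

lemma psd_form_zero_imp_kernel:
  assumes X: "psd X" and w: "w \<bullet> (X *v w) = 0"
  shows "X *v w = 0"
proof (rule ccontr)
  assume nz: "X *v w \<noteq> 0"
  define u where "u = X *v w"
  define k where "k = (u \<bullet> (X *v w))\<^sup>2"
  have k: "k > 0" using nz by (simp add: k_def u_def)
  have a: "0 \<le> u \<bullet> (X *v u)" using X by (simp add: psd_def)
  have "(u \<bullet> (X *v u) + 1) / k * k \<le> u \<bullet> (X *v u)"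
    unfolding k_def using psd_form_square_le[OF X, of "(u \<bullet> (X *v u) + 1) / k" w u] a k w
    by (simp add: k_def)
  with k show False by simp
qed

lemma psd_0: "psd 0"
  by (simp add: psd_def subspace_0[OF subspace_Sym])

lemma psd_add: "psd X \<Longrightarrow> psd Y \<Longrightarrow> psd (X + Y)"
  by (simp add: psd_def subspace_add[OF subspace_Sym] matrix_vector_mult_add_rdistrib inner_add_right)

lemma psd_scaleR: "0 \<le> c \<Longrightarrow> psd X \<Longrightarrow> psd (c *\<^sub>R X)"
  by (simp add: psd_def subspace_scale[OF subspace_Sym] scaleR_matrix_vector_assoc[symmetric])

section \<open>Rank-one matrices and congruences\<close>

definition outer_square :: "real ^ 'n \<Rightarrow> real ^ 'n ^ 'n" where
  "outer_square x = (\<chi> i j. x $ i * x $ j)"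

lemma outer_square_mult_vec: "outer_square x *v v = (x \<bullet> v) *\<^sub>R x"
  by (simp add: outer_square_def matrix_vector_mult_def vec_eq_iff inner_vec_def
      sum_distrib_left mult.commute mult.left_commute)

lemma outer_square_Sym: "outer_square x \<in> Sym"
  by (simp add: outer_square_def Sym_def transpose_def vec_eq_iff)

lemma psd_outer_square: "psd (outer_square x)"
  by (simp add: psd_def outer_square_Sym outer_square_mult_vec inner_commute)

lemma inner_outer_square: "X \<bullet> outer_square v = v \<bullet> (X *v v)"
  by (simp add: inner_vec_def outer_square_def matrix_vector_mult_def sum_distrib_left
      mult.commute mult.left_commute)

lemma outer_square_congruence:
  "B ** outer_square v ** transpose B = outer_square (B *v v)"
  unfolding matrix_eq matrix_vector_mul_assoc[symmetric]
  by (simp add: outer_square_mult_vec matrix_vector_mult_scaleR inner_commute[of v]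
      inner_commute[of "B *v v"] dot_lmul_matrix)

text \<open>Cyclicity of the trace moves a congruence from a functional to its argument.\<close>

lemma inner_congruence:
  fixes B Q X :: "real ^ 'n ^ 'n"
  shows "(B ** Q ** transpose B) \<bullet> X = Q \<bullet> (transpose B ** X ** B)"
proof -
  have "(B ** Q ** transpose B) \<bullet> X = trace (transpose X ** (B ** Q ** transpose B))"
    by (simp add: sym_inner_def flip: sym_inner_eq_inner)
  also have "\<dots> = trace ((transpose X ** (B ** Q)) ** transpose B)"
    by (simp add: matrix_mul_assoc)
  also have "\<dots> = trace (transpose B ** (transpose X ** (B ** Q)))"
    by (rule trace_mul_sym)
  also have "\<dots> = trace (transpose (transpose B ** X ** B) ** Q)"
    by (simp add: matrix_transpose_mul matrix_mul_assoc)
  also have "\<dots> = Q \<bullet> (transpose B ** X ** B)"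
    by (simp add: sym_inner_def flip: sym_inner_eq_inner)
  finally show ?thesis .
qed

section \<open>Generalized inverses and faces of the semidefinite cone\<close>

text \<open>\<open>S\<close> represents a linear map that chooses a preimage of every vector in the
  range of \<open>X\<close>.\<close>

lemma generalized_inverse_exists:
  fixes X :: "real ^ 'n ^ 'm"
  obtains S where "X ** S ** X = X"
proof -
  obtain g where g: "linear g" "\<forall>v\<in>range ((*v) X). X *v g v = v"
    using linear_exists_right_inverse_on[OF matrix_vector_mul_linear[of X] subspace_UNIV] by auto
  have "X ** matrix g ** X = X"
    using g by (simp add: matrix_eq matrix_vector_mul_assoc[symmetric] matrix_works)
  then show thesis using that by blast
qed

text \<open>
  The face of the cone of positive semidefinite matrices generated by \<open>Xs\<close> is the image of the
  whole cone under the congruence with \<open>S ** Xs\<close>, where \<open>S\<close> is a generalized inverse of \<open>Xs\<close>.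
  Hence a functional that is nonpositive on the face extends to one nonpositive on the cone.
\<close>
lemma nsd_extension_from_face:
  fixes Xs q :: "real ^ 'n ^ 'n"
  assumes Xs: "psd Xs" and q: "q \<in> Sym"
    and neg: "\<And>P e. psd P \<Longrightarrow> 0 < e \<Longrightarrow> psd (Xs - e *\<^sub>R P) \<Longrightarrow> q \<bullet> P \<le> 0"
  obtains Q where "nsd Q" "\<And>X e. psd X \<Longrightarrow> 0 < e \<Longrightarrow> psd (Xs - e *\<^sub>R X) \<Longrightarrow> Q \<bullet> X = q \<bullet> X"
proof -
  obtain S where S: "Xs ** S ** Xs = Xs" by (rule generalized_inverse_exists)
  define B where "B = S ** Xs"
  have tXs: "transpose Xs = Xs" using Xs by (simp add: psd_def Sym_def)
  define Q where "Q = B ** q ** transpose B"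
  have range: "q \<bullet> outer_square (Xs *v w) \<le> 0" for w
  proof -
    \<comment> \<open>A small enough \<open>c\<close> puts \<open>c\<close> times the rank-one
      matrix below \<open>Xs\<close>, so this matrix lies in the face; the 1 in the denominator
      covers \<open>w \<bullet> (Xs *v w) = 0\<close>.\<close>
    define c where "c = 1 / (1 + w \<bullet> (Xs *v w))"
    have w: "0 \<le> w \<bullet> (Xs *v w)" using Xs by (simp add: psd_def)
    then have c: "c > 0" "c * (w \<bullet> (Xs *v w)) \<le> 1" by (auto simp: c_def field_simps)
    have "psd (Xs - c *\<^sub>R outer_square (Xs *v w))"
      unfolding psd_def
    proof (intro conjI allI)
      show "Xs - c *\<^sub>R outer_square (Xs *v w) \<in> Sym"
        using Xs by (intro subspace_diff subspace_scale subspace_Sym outer_square_Sym)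
          (simp add: psd_def)
      fix u
      show "0 \<le> u \<bullet> ((Xs - c *\<^sub>R outer_square (Xs *v w)) *v u)"
        using psd_form_square_le[OF Xs _ c(2), of u] c(1)
        by (simp add: matrix_vector_mult_diff_rdistrib scaleR_matrix_vector_assoc[symmetric]
            inner_diff_right outer_square_mult_vec power2_eq_square inner_commute)
    qed
    then show ?thesis using neg psd_outer_square c(1) by blast
  qed
  show thesis
  proof (rule that[of Q])
    have "transpose Q = Q"
      using q by (simp add: Q_def Sym_def matrix_transpose_mul matrix_mul_assoc)
    moreover have "v \<bullet> (Q *v v) \<le> 0" for v
    proof -
      \<comment> \<open>Since \<open>transpose B = Xs ** transpose S\<close>, the congruence sends
        the square of \<open>v\<close> to that of a vector in the range of \<open>Xs\<close>, where
        \<open>range\<close> applies.\<close>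
      have "v \<bullet> (Q *v v) = q \<bullet> (transpose B ** outer_square v ** transpose (transpose B))"
        by (simp add: Q_def inner_congruence flip: inner_outer_square)
      also have "\<dots> = q \<bullet> outer_square (Xs *v (transpose S *v v))"
        unfolding outer_square_congruence
        by (simp add: B_def matrix_transpose_mul tXs matrix_vector_mul_assoc del: transpose_matrix_vector)
      finally show ?thesis using range by simp
    qed
    ultimately show "nsd Q" by (simp add: nsd_def Sym_def)
  next
    fix X e assume X: "psd X" and e: "0 < (e::real)" and le: "psd (Xs - e *\<^sub>R X)"
    have tX: "transpose X = X" using X by (simp add: psd_def Sym_def)
    have ker: "X *v k = 0" if "Xs *v k = 0" for k
    proof (rule psd_form_zero_imp_kernel[OF X])
      have "0 \<le> k \<bullet> ((Xs - e *\<^sub>R X) *v k)" using le by (simp add: psd_def)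
      then have "e * (k \<bullet> (X *v k)) \<le> 0"
        using that by (simp add: matrix_vector_mult_diff_rdistrib
            scaleR_matrix_vector_assoc[symmetric] inner_diff_right)
      moreover have "0 \<le> k \<bullet> (X *v k)" using X by (simp add: psd_def)
      ultimately show "k \<bullet> (X *v k) = 0" using e by (simp add: mult_le_0_iff)
    qed
    \<comment> \<open>\<open>Xs ** B = Xs\<close>, so \<open>B *v v - v\<close> lies in the kernel
      of \<open>Xs\<close> and hence in that of \<open>X\<close>. The congruence therefore fixes
      \<open>X\<close>.\<close>
    have XB: "X ** B = X"
      unfolding matrix_eq
    proof
      fix v
      have "Xs *v (B *v v - v) = 0"
        using S by (simp add: B_def matrix_vector_mult_diff_distrib matrix_vector_mul_assoc
            matrix_mul_assoc)
      from ker[OF this] show "(X ** B) *v v = X *v v"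
        by (simp add: matrix_vector_mult_diff_distrib matrix_vector_mul_assoc)
    qed
    then have "transpose (X ** B) = transpose X" by simp
    then have "transpose B ** X = X" by (simp add: matrix_transpose_mul tX)
    with XB show "Q \<bullet> X = q \<bullet> X" by (simp add: Q_def inner_congruence)
  qed
qed

section \<open>The additional constraint and the certificate\<close>

theorem corollary2:
  fixes f :: "real ^ 'n ^ 'n \<Rightarrow> real"
    and m :: nat
    and A :: "real ^ 'n ^ 'n \<Rightarrow> nat \<Rightarrow> real"
    and b :: "nat \<Rightarrow> real"
    and x0 :: "real ^ 'n"
    and X0 :: "real ^ 'n ^ 'n"
  assumes "convex_on Sym f"
    and "continuous_on Sym f"
    and "linear_Sym m A"
    and "X0 = (\<chi> i j. x0 $ i * x0 $ j)"
    and "\<forall>i<m. b i = A X0 i"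
    and "is_arg_min f (\<lambda>X. X \<in> feasible m A b) X0"
  shows "\<exists>(m' :: nat) (A' :: real ^ 'n ^ 'n \<Rightarrow> nat \<Rightarrow> real) (b' :: nat \<Rightarrow> real).
           m' > 0 \<and> linear_Sym m' A' \<and>
           feasible m A b = feasible m' A' b' \<and>
           (\<exists>l Q. dual_certificate f m' A' b' X0 l Q)"
proof -
  let ?F = "feasible m A b"
  have X0F: "X0 \<in> ?F" and min: "\<And>Y. Y \<in> ?F \<Longrightarrow> f X0 \<le> f Y"
    using assms(6) by (auto simp: is_arg_min_linorder)
  have X0: "X0 \<in> Sym" "psd X0" using X0F by (auto simp: feasible_def)
  define M where "M = {X \<in> Sym. \<forall>i<m. A X i = b i}"
  have affM: "affine M"
    using assms(3) unfolding affine_def M_def linear_Sym_def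
    by (auto simp: subspace_add[OF subspace_Sym] subspace_scale[OF subspace_Sym]
        simp flip: distrib_right)
  have F_eq: "?F = Collect psd \<inter> M" by (auto simp: feasible_def M_def)
  have "convex (Collect psd :: (real ^ 'n ^ 'n) set)"
    by (auto simp: convex_def intro: psd_add psd_scaleR)
  then have convF: "convex ?F"
    unfolding F_eq by (rule convex_Int[OF _ affine_imp_convex[OF affM]])
  obtain G where G: "G \<in> Sym"
      "\<And>X Y. X \<in> Sym \<Longrightarrow> Y \<in> ?F \<Longrightarrow> f X0 + G \<bullet> (X - Y) \<le> f X"
    using constrained_minimum_subgradient[OF subspace_Sym assms(1) convF _ X0F min]
    by (auto simp: feasible_def)
  have Gpos: "0 \<le> G \<bullet> (X - X0)" if "psd X" "X \<in> M" for X
    using G(2)[of X0 X] X0 that F_eq by (simp add: inner_diff_right)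
  obtain Xs q where Xs: "psd Xs" and q: "q \<in> span (Collect psd)"
    and face: "\<And>X. psd X \<Longrightarrow> X \<in> M \<Longrightarrow> \<exists>e>0. psd (Xs - e *\<^sub>R X)"
    and neg: "\<And>P e. psd P \<Longrightarrow> 0 < e \<Longrightarrow> psd (Xs - e *\<^sub>R P) \<Longrightarrow> q \<bullet> P \<le> 0"
    and qX0: "q \<bullet> X0 = 0"
    and orth: "\<And>X. psd X \<Longrightarrow> X \<in> M \<Longrightarrow> (G + q) \<bullet> (X - X0) = 0"
  proof (rule minimal_face_multiplier[of "Collect psd" M X0 G])
    show "X0 \<in> M" using X0F F_eq by auto
  qed (use affM Gpos X0 psd_0 psd_add psd_scaleR in auto)
  have "span (Collect psd) \<subseteq> (Sym :: (real ^ 'n ^ 'n) set)"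
    by (intro span_minimal subspace_Sym) (auto simp: psd_def)
  with q have "q \<in> Sym" by auto
  then obtain Q where Q: "nsd Q"
    and Qq: "\<And>X e. psd X \<Longrightarrow> 0 < e \<Longrightarrow> psd (Xs - e *\<^sub>R X) \<Longrightarrow> Q \<bullet> X = q \<bullet> X"
    using nsd_extension_from_face[of Xs q] Xs neg by blast
  have QF: "Q \<bullet> X = q \<bullet> X" if "X \<in> ?F" for X
    using face[of X] Qq[of X] that F_eq by auto
  \<comment> \<open>The signs make \<open>Y + Q = - G\<close>. On the feasible set \<open>Q\<close>
    agrees with \<open>q\<close>, so orthogonality of \<open>G + q\<close> to \<open>X - X0\<close>
    makes \<open>Y\<close> constant there.\<close>
  define Y where "Y = - G - Q"
  have Y: "Y \<in> Sym"
    unfolding Y_def using G(1) Q by (intro subspace_diff subspace_neg subspace_Sym)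
      (simp_all add: nsd_def)
  have YF: "X \<bullet> Y = X0 \<bullet> Y" if "X \<in> ?F" for X
    using orth[of X] that F_eq QF[OF that] QF[OF X0F]
    by (simp add: Y_def inner_diff_left inner_diff_right inner_add_left inner_commute[of _ q]
        inner_commute[of _ Q] inner_commute[of _ G])
  \<comment> \<open>Index \<open>m\<close> carries the new row, so the number of rows is positive
    even for \<open>m = 0\<close>.\<close>
  define A' where "A' X i = (if i < m then A X i else X \<bullet> Y)" for X i
  define l :: "nat \<Rightarrow> real" where "l i = (if i < m then 0 else 1)" for i
  have lin: "linear_Sym (Suc m) A'"
    using assms(3) by (simp add: linear_Sym_def A'_def inner_add_left)
  have "Y \<in> Sym \<and> (\<forall>X\<in>Sym. sym_inner X Y = (\<Sum>i<Suc m. A' X i * l i))"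
    using Y by (simp add: A'_def l_def sym_inner_eq_inner)
  then have adj: "adjoint_Sym (Suc m) A' l = Y"
    unfolding adjoint_Sym_def using ex1_adjoint_Sym[OF lin] by (intro the1_equality)
  \<comment> \<open>The old entries of \<open>A' X0\<close> equal those of \<open>b\<close>, and by
    \<open>YF\<close> the new row holds on the whole feasible set.\<close>
  have "feasible m A b = feasible (Suc m) A' (A' X0)"
    using YF assms(5) by (auto simp: feasible_def A'_def less_Suc_eq)
  moreover have "dual_certificate f (Suc m) A' (A' X0) X0 l Q"
    unfolding dual_certificate_def adj
  proof (intro conjI)
    have "G \<in> subdiff f X0"
      using G X0F by (simp add: subdiff_def sym_inner_eq_inner)
    then show "Y + Q \<in> uminus ` subdiff f X0" by (simp add: Y_def)
    show "sym_inner Q X0 = 0" using QF[OF X0F] qX0 by (simp add: sym_inner_eq_inner)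
  qed (use Q in auto)
  ultimately show ?thesis using lin by blast
qed

end
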